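(* Let $M=(E,\rho)$ be a matroid and $Y\subseteq E$ a subset of full rank, i.e. $\rho(Y)=\rho(E)$. Let $k=\rho(Y)$ and $n=|Y|$. Then $M|Y$ is isomorphic to the uniform matroid $U_n^k$ if and only if either $Y$ is a basis of $M$, or the following two conditions are satisfied: (1) $Y$ is a cyclic set of $M$; (2) for all $Z\in\mathcal{Z}(M)$ with $\rho(Z)<k$, the set $Z\cap Y$ is independent in $M$.
   Context: A matroid $M=(E,\rho)$ is given by its rank function. The cyclic operator is $\mathrm{cyc}(X)=\{e\in X:\rho(X-e)=\rho(X)\}$, the closure operator is $\mathrm{cl}(X)=\{e\in E:\rho(X\cup e)=\rho(X)\}$. A set $X$ is cyclic if $\mathrm{cyc}(X)=X$, a flat if $\mathrm{cl}(X)=X$, and a cyclic flat if both; $\mathcal{Z}(M)$ is the set of cyclic flats. $M|Y$ is the restriction of $M$ to $Y$. $U_n^k$ is the uniform matroid on $n$ elements with rank function $A\mapsto\min\{|A|,k\}$. *)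

theory Defs
  imports Main
begin

text \<open>
  Finite matroids given by their rank function. Only the values of \<open>rk M\<close> on subsets of
  \<open>ground M\<close> are meaningful; its values on other sets are junk and are never inspected.
\<close>

record 'a rank_structure =
  ground :: "'a set"
  rk :: "'a set \<Rightarrow> nat"

definition matroid :: "'a rank_structure \<Rightarrow> bool" where
  "matroid M \<longleftrightarrow>
     finite (ground M) \<and>
     (\<forall>X. X \<subseteq> ground M \<longrightarrow> rk M X \<le> card X) \<and>
     (\<forall>X Y. X \<subseteq> Y \<longrightarrow> Y \<subseteq> ground M \<longrightarrow> rk M X \<le> rk M Y) \<and>
     (\<forall>X Y. X \<subseteq> ground M \<longrightarrow> Y \<subseteq> ground M \<longrightarrow>
        rk M (X \<union> Y) + rk M (X \<inter> Y) \<le> rk M X + rk M Y)"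

definition independent :: "'a rank_structure \<Rightarrow> 'a set \<Rightarrow> bool" where
  "independent M X \<longleftrightarrow> X \<subseteq> ground M \<and> rk M X = card X"

definition basis :: "'a rank_structure \<Rightarrow> 'a set \<Rightarrow> bool" where
  "basis M B \<longleftrightarrow> independent M B \<and> (\<forall>X. independent M X \<longrightarrow> B \<subseteq> X \<longrightarrow> X = B)"

definition cyc :: "'a rank_structure \<Rightarrow> 'a set \<Rightarrow> 'a set" where
  "cyc M X = {e \<in> X. rk M (X - {e}) = rk M X}"

definition cl :: "'a rank_structure \<Rightarrow> 'a set \<Rightarrow> 'a set" where
  "cl M X = {e \<in> ground M. rk M (X \<union> {e}) = rk M X}"

definition cyclic :: "'a rank_structure \<Rightarrow> 'a set \<Rightarrow> bool" where
  "cyclic M X \<longleftrightarrow> X \<subseteq> ground M \<and> cyc M X = X"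

definition flat :: "'a rank_structure \<Rightarrow> 'a set \<Rightarrow> bool" where
  "flat M X \<longleftrightarrow> X \<subseteq> ground M \<and> cl M X = X"

definition cyclic_flats :: "'a rank_structure \<Rightarrow> 'a set set" where
  "cyclic_flats M = {Z. cyclic M Z \<and> flat M Z}"

definition restriction :: "'a rank_structure \<Rightarrow> 'a set \<Rightarrow> 'a rank_structure" where
  "restriction M Y = \<lparr>ground = Y, rk = rk M\<rparr>"

text \<open>\<open>uniform_matroid n k\<close> is the matroid written \<open>U\<close> with subscript \<open>n\<close> and superscript \<open>k\<close>.\<close>

definition uniform_matroid :: "nat \<Rightarrow> nat \<Rightarrow> nat rank_structure" where
  "uniform_matroid n k = \<lparr>ground = {..<n}, rk = (\<lambda>A. min (card A) k)\<rparr>"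

definition isomorphic :: "'a rank_structure \<Rightarrow> 'b rank_structure \<Rightarrow> bool" where
  "isomorphic M N \<longleftrightarrow>
     (\<exists>f. bij_betw f (ground M) (ground N) \<and>
          (\<forall>A. A \<subseteq> ground M \<longrightarrow> rk N (f ` A) = rk M A))"

lemma matroid_restriction:
  assumes "matroid M" "Y \<subseteq> ground M"
  shows "matroid (restriction M Y)"
  using assms unfolding matroid_def restriction_def
  by (auto intro: finite_subset dest: order_trans)

lemma matroid_uniform_matroid: "matroid (uniform_matroid n k)"
proof -
  have sub: "min (card (X \<union> Y)) k + min (card (X \<inter> Y)) k \<le> min (card X) k + min (card Y) k"
    if "X \<subseteq> {..<n}" "Y \<subseteq> {..<n}" for X Y
  proof -
    have fin: "finite X" "finite Y"
      using that finite_subset by blast+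
    have "card (X \<union> Y) + card (X \<inter> Y) = card X + card Y"
      using card_Un_Int[OF fin] by simp
    moreover have "card (X \<inter> Y) \<le> card X" "card (X \<inter> Y) \<le> card Y"
      using fin by (simp_all add: card_mono)
    ultimately show ?thesis by linarith
  qed
  have mono: "min (card X) k \<le> min (card Y) k" if "X \<subseteq> Y" "Y \<subseteq> {..<n}" for X Y :: "nat set"
    using card_mono[OF finite_subset[OF that(2)] that(1)] by (simp add: min.coboundedI1)
  show ?thesis
    unfolding matroid_def uniform_matroid_def using sub mono by simp
qed

end

theory Submission
  imports Defs
begin

text \<open>
  The restriction to \<open>Y\<close> is uniform exactly when every \<open>A \<subseteq> Y\<close> has rank \<open>min (card A) k\<close>. A set
  \<open>A \<subseteq> Y\<close> violating this has rank below \<open>k\<close> and contains a circuit \<open>C\<close>. The closure of \<open>C\<close> is a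
  cyclic flat of rank below \<open>k\<close> whose intersection with \<open>Y\<close> contains \<open>C\<close>, hence is dependent.
\<close>

lemma matroid_rk_le_card: "matroid M \<Longrightarrow> X \<subseteq> ground M \<Longrightarrow> rk M X \<le> card X"
  by (simp add: matroid_def)

lemma matroid_rk_mono: "matroid M \<Longrightarrow> X \<subseteq> Y \<Longrightarrow> Y \<subseteq> ground M \<Longrightarrow> rk M X \<le> rk M Y"
  by (simp add: matroid_def)

lemma matroid_rk_submodular:
  "matroid M \<Longrightarrow> X \<subseteq> ground M \<Longrightarrow> Y \<subseteq> ground M \<Longrightarrow>
    rk M (X \<union> Y) + rk M (X \<inter> Y) \<le> rk M X + rk M Y"
  by (simp add: matroid_def)

lemma matroid_finite_subset: "matroid M \<Longrightarrow> X \<subseteq> ground M \<Longrightarrow> finite X"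
  by (auto simp: matroid_def intro: finite_subset)

text \<open>Submodularity bounds \<open>card X = rk M X\<close> by
  \<open>rk M A + rk M (X - A)\<close>. Each of these two ranks is at most the corresponding
  cardinality, and the cardinalities add up to \<open>card X\<close>, so neither bound can be
  strict.\<close>

lemma independent_subset:
  assumes M: "matroid M" and X: "independent M X" and AX: "A \<subseteq> X"
  shows "independent M A"
proof -
  have XE: "X \<subseteq> ground M" and rX: "rk M X = card X"
    using X by (auto simp: independent_def)
  have fX: "finite X" using M XE by (rule matroid_finite_subset)
  have "rk M X \<le> rk M A + rk M (X - A)"
    using matroid_rk_submodular[OF M, of A "X - A"] AX XE
    by (simp add: Un_absorb1 subset_trans[OF AX] Diff_subset[THEN subset_trans])
  moreover have "rk M (X - A) \<le> card (X - A)"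
    using matroid_rk_le_card[OF M] XE by blast
  moreover have "card X = card A + card (X - A)"
    using AX fX by (metis card_Diff_subset card_mono finite_subset le_add_diff_inverse)
  moreover have "rk M A \<le> card A"
    using matroid_rk_le_card[OF M] AX XE by blast
  ultimately show ?thesis
    using rX AX XE by (simp add: independent_def)
qed

lemma subset_cl:
  assumes "X \<subseteq> ground M"
  shows "X \<subseteq> cl M X"
  using assms by (auto simp: cl_def insert_absorb)

text \<open>Each single element of the closure leaves the rank of \<open>X\<close> unchanged by
  definition; submodularity extends this to adding all of them, one at a time.\<close>

lemma rk_cl:
  assumes M: "matroid M" and XE: "X \<subseteq> ground M"
  shows "rk M (cl M X) = rk M X"
proof -
  have clE: "cl M X \<subseteq> ground M" by (auto simp: cl_def)
  have "rk M (X \<union> F) = rk M X" if "finite F" "F \<subseteq> cl M X" for F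
    using that
  proof (induction F rule: finite_induct)
    case (insert e F)
    have e: "rk M (X \<union> {e}) = rk M X" and IH: "rk M (X \<union> F) = rk M X"
      and E: "X \<union> F \<subseteq> ground M" "X \<union> {e} \<subseteq> ground M"
      using insert clE XE by (auto simp: cl_def)
    \<comment> \<open>Both terms on the right equal \<open>rk M X\<close>, and the intersection on
      the left contains \<open>X\<close>, so the union has rank at most
      \<open>rk M X\<close>.\<close>
    have "rk M (X \<union> insert e F) + rk M ((X \<union> F) \<inter> (X \<union> {e})) \<le> rk M (X \<union> F) + rk M (X \<union> {e})"
      using matroid_rk_submodular[OF M E] by (simp add: Un_ac)
    moreover have "rk M X \<le> rk M ((X \<union> F) \<inter> (X \<union> {e}))"
      using E by (intro matroid_rk_mono[OF M]) auto
    moreover have "rk M X \<le> rk M (X \<union> insert e F)"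
      using E by (intro matroid_rk_mono[OF M]) auto
    ultimately show ?case using e IH by linarith
  qed simp
  from this[OF matroid_finite_subset[OF M clE]] show ?thesis
    using subset_cl[OF XE] by (simp add: Un_absorb1)
qed

text \<open>If \<open>e\<close> does not raise the rank of \<open>cl M X\<close>, then by
  monotonicity \<open>X \<union> {e}\<close> has rank at most \<open>rk M (cl M X) = rk M X\<close>,
  which puts \<open>e\<close> in \<open>cl M X\<close> already.\<close>

lemma flat_cl:
  assumes M: "matroid M" and XE: "X \<subseteq> ground M"
  shows "flat M (cl M X)"
proof -
  have clE: "cl M X \<subseteq> ground M" by (auto simp: cl_def)
  have "e \<in> cl M X" if e: "e \<in> cl M (cl M X)" for e
  proof -
    have "rk M (X \<union> {e}) \<le> rk M (cl M X \<union> {e})"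
      using e clE subset_cl[OF XE] by (intro matroid_rk_mono[OF M]) (auto simp: cl_def)
    also have "\<dots> = rk M X"
      using e rk_cl[OF M XE] by (simp add: cl_def)
    finally have "rk M (X \<union> {e}) \<le> rk M X" .
    moreover have "rk M X \<le> rk M (X \<union> {e})"
      using e XE by (intro matroid_rk_mono[OF M]) (auto simp: cl_def)
    ultimately show ?thesis
      using e by (simp add: cl_def)
  qed
  then show ?thesis
    using clE subset_cl[OF clE] by (auto simp: flat_def)
qed

text \<open>Deleting any \<open>e\<close> from the closure leaves a superset of
  \<open>X - {e}\<close>. That set still has rank \<open>rk M X\<close>, by cyclicity if
  \<open>e\<close> lies in \<open>X\<close> and trivially otherwise, and this is the rank of the
  closure.\<close>

lemma cyclic_cl:
  assumes M: "matroid M" and X: "cyclic M X"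
  shows "cyclic M (cl M X)"
proof -
  have XE: "X \<subseteq> ground M" using X by (simp add: cyclic_def)
  have clE: "cl M X \<subseteq> ground M" by (auto simp: cl_def)
  have "rk M (cl M X - {e}) = rk M (cl M X)" if e: "e \<in> cl M X" for e
  proof -
    have le: "rk M (cl M X - {e}) \<le> rk M (cl M X)"
      using clE by (intro matroid_rk_mono[OF M]) auto
    have "rk M X = rk M (X - {e})"
    proof (cases "e \<in> X")
      case True
      then have "e \<in> cyc M X" using X by (simp add: cyclic_def)
      then show ?thesis by (simp add: cyc_def)
    qed simp
    also have "\<dots> \<le> rk M (cl M X - {e})"
      using clE subset_cl[OF XE] by (intro matroid_rk_mono[OF M]) auto
    finally show ?thesis using le rk_cl[OF M XE] by simp
  qed
  then show ?thesis
    using clE by (auto simp: cyclic_def cyc_def)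
qed

text \<open>A minimal dependent subset, that is a circuit, is cyclic: all its proper subsets are
  independent, so deleting one element leaves rank one below its size, which is the most a dependent
  set can have.\<close>

lemma dependent_contains_cyclic_dependent:
  assumes M: "matroid M" and AE: "A \<subseteq> ground M" and A: "\<not> independent M A"
  obtains C where "C \<subseteq> A" "\<not> independent M C" "cyclic M C"
proof -
  have "finite A" using M AE by (rule matroid_finite_subset)
  then have "\<exists>C \<subseteq> A. \<not> independent M C \<and> cyclic M C"
    using AE A
  proof (induction A rule: finite_psubset_induct)
    case (psubset A)
    show ?case
    proof (cases "\<exists>B \<subset> A. \<not> independent M B")
      case True
      then obtain B where B: "B \<subset> A" "\<not> independent M B" by blast
      then have "B \<subseteq> ground M" using psubset.prems by blast
      with B show ?thesis
        using psubset.IH[of B] by blast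
    next
      case False
      have "rk M (A - {e}) = rk M A" if e: "e \<in> A" for e
      proof -
        have "independent M (A - {e})" using False e by blast
        then have "rk M (A - {e}) = card A - 1"
          using e psubset.hyps by (simp add: independent_def)
        moreover have "rk M A < card A"
          using psubset.prems matroid_rk_le_card[OF M] by (simp add: independent_def order_less_le)
        moreover have "rk M (A - {e}) \<le> rk M A"
          using psubset.prems by (intro matroid_rk_mono[OF M]) auto
        ultimately show ?thesis by linarith
      qed
      then have "cyclic M A"
        using psubset.prems by (auto simp: cyclic_def cyc_def)
      then show ?thesis using psubset.prems by blast
    qed
  qed
  then show ?thesis using that by blast
qed

text \<open>Bijections preserve cardinality and uniform rank depends on cardinality alone, so the
  choice of bijection is immaterial and isomorphism becomes a rank formula on subsets of
  \<open>Y\<close>.\<close>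

lemma isomorphic_restriction_uniform_iff:
  assumes "finite Y"
  shows "isomorphic (restriction M Y) (uniform_matroid (card Y) k) \<longleftrightarrow>
    (\<forall>A \<subseteq> Y. rk M A = min (card A) k)"
proof
  assume "isomorphic (restriction M Y) (uniform_matroid (card Y) k)"
  then obtain f where f: "bij_betw f Y {..<card Y}"
    and r: "\<And>A. A \<subseteq> Y \<Longrightarrow> min (card (f ` A)) k = rk M A"
    by (auto simp: isomorphic_def restriction_def uniform_matroid_def)
  have "card (f ` A) = card A" if "A \<subseteq> Y" for A
    using f that by (meson bij_betw_def card_image inj_on_subset)
  then show "\<forall>A \<subseteq> Y. rk M A = min (card A) k"
    using r by metis
next
  assume r: "\<forall>A \<subseteq> Y. rk M A = min (card A) k"
  obtain f where f: "bij_betw f Y {..<card Y}"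
    using ex_bij_betw_finite_nat[OF assms] by (auto simp: atLeast0LessThan)
  have "card (f ` A) = card A" if "A \<subseteq> Y" for A
    using f that by (meson bij_betw_def card_image inj_on_subset)
  then show "isomorphic (restriction M Y) (uniform_matroid (card Y) k)"
    unfolding isomorphic_def restriction_def uniform_matroid_def
    using f r by (intro exI[of _ f]) simp
qed

text \<open>Bases are defined by maximality. An independent superset has size equal to its rank,
  hence at most \<open>rk M (ground M) = card B\<close>.\<close>

lemma spanning_independent_imp_basis:
  assumes M: "matroid M" and B: "independent M B" and r: "rk M B = rk M (ground M)"
  shows "basis M B"
proof -
  have "X = B" if X: "independent M X" "B \<subseteq> X" for X
  proof -
    have XE: "X \<subseteq> ground M" using X by (simp add: independent_def)
    have "card X \<le> card B"
      using matroid_rk_mono[OF M XE order_refl] X B r by (simp add: independent_def)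
    then show ?thesis
      using X matroid_finite_subset[OF M XE] by (metis card_seteq)
  qed
  then show ?thesis using B by (simp add: basis_def)
qed

theorem theorem4p1:
  fixes M :: "'a rank_structure" and Y :: "'a set" and k n :: nat
  assumes "matroid M"
    and "Y \<subseteq> ground M"
    and "rk M Y = rk M (ground M)"
    and "k = rk M Y"
    and "n = card Y"
  shows "isomorphic (restriction M Y) (uniform_matroid n k) \<longleftrightarrow>
    basis M Y \<or>
    (cyclic M Y \<and>
     (\<forall>Z \<in> cyclic_flats M. rk M Z < k \<longrightarrow> independent M (Z \<inter> Y)))"
proof -
  note M = assms(1) and YE = assms(2)
  have fY: "finite Y" using M YE by (rule matroid_finite_subset)
  have kn: "k \<le> card Y" using matroid_rk_le_card[OF M YE] assms(4) by simp
  let ?U = "\<forall>A \<subseteq> Y. rk M A = min (card A) k"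
  let ?P = "\<forall>Z \<in> cyclic_flats M. rk M Z < k \<longrightarrow> independent M (Z \<inter> Y)"
  have "?U \<longleftrightarrow> basis M Y \<or> (cyclic M Y \<and> ?P)"
  proof
    assume U: ?U
    show "basis M Y \<or> (cyclic M Y \<and> ?P)"
    \<comment> \<open>Equality is the free case, where \<open>Y\<close> is a basis. Otherwise
      \<open>k < card Y\<close>, so removing one element leaves at least \<open>k\<close> elements
      and the minimum stays at \<open>k\<close>.\<close>
    proof (cases "card Y = k")
      case True
      then have "independent M Y" using YE assms(4) by (simp add: independent_def)
      then show ?thesis using spanning_independent_imp_basis[OF M] assms(3) by blast
    next
      case False
      have "rk M (Y - {e}) = rk M Y" if "e \<in> Y" for e
      proof -
        have "rk M (Y - {e}) = min (card Y - 1) k"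
          using U[rule_format, of "Y - {e}"] that by (simp add: card_Diff_singleton)
        then show ?thesis using False kn assms(4) by linarith
      qed
      then have "cyclic M Y" using YE by (auto simp: cyclic_def cyc_def)
      moreover have "independent M (Z \<inter> Y)" if Z: "Z \<in> cyclic_flats M" "rk M Z < k" for Z
      proof -
        have "rk M (Z \<inter> Y) \<le> rk M Z"
          using Z(1) by (intro matroid_rk_mono[OF M]) (auto simp: cyclic_flats_def flat_def)
        \<comment> \<open>As this rank is below \<open>k\<close>, the minimum must be attained by
          the cardinality.\<close>
        moreover have "rk M (Z \<inter> Y) = min (card (Z \<inter> Y)) k" using U by blast
        ultimately show ?thesis
          using Z(2) YE by (auto simp: independent_def)
      qed
      ultimately show ?thesis by blast
    qed
  next
    assume R: "basis M Y \<or> (cyclic M Y \<and> ?P)"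
    show ?U
    proof (intro allI impI)
      fix A assume AY: "A \<subseteq> Y"
      have AE: "A \<subseteq> ground M" using AY YE by simp
      have Ak: "rk M A \<le> k" using matroid_rk_mono[OF M AY YE] assms(4) by simp
      have Ac: "rk M A \<le> card A" using M AE by (rule matroid_rk_le_card)
      show "rk M A = min (card A) k"
      proof (cases "independent M A")
        case True
        then show ?thesis using Ak by (simp add: independent_def)
      next
        case dep: False
        \<comment> \<open>The basis alternative is excluded: subsets of a basis are independent,
          whereas \<open>A\<close> is dependent.\<close>
        have P: ?P
          using R dep independent_subset[OF M _ AY] by (auto simp: basis_def)
        obtain C where C: "C \<subseteq> A" "\<not> independent M C" "cyclic M C"
          using dependent_contains_cyclic_dependent[OF M AE dep] .
        have CE: "C \<subseteq> ground M" using C(1) AE by simp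
        have Z: "cl M C \<in> cyclic_flats M"
          using flat_cl[OF M CE] cyclic_cl[OF M C(3)] by (simp add: cyclic_flats_def)
        have "C \<subseteq> cl M C \<inter> Y" using subset_cl[OF CE] C(1) AY by blast
        then have "\<not> independent M (cl M C \<inter> Y)"
          using independent_subset[OF M] C(2) by blast
        \<comment> \<open>The contrapositive of \<open>?P\<close> at the cyclic flat
          \<open>cl M C\<close>. Since this flat has the rank of \<open>C\<close>, the bound passes
          to \<open>A\<close>.\<close>
        then have "k \<le> rk M (cl M C)" using P Z by (meson not_le_imp_less)
        also have "\<dots> \<le> rk M A"
          using rk_cl[OF M CE] matroid_rk_mono[OF M C(1) AE] by simp
        finally show ?thesis using Ak Ac by simp
      qed
    qed
  qed
  then show ?thesis
    using isomorphic_restriction_uniform_iff[OF fY] assms(5) by blast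
qed

end
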